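(* Let $q$ be a fixed nonzero complex number with $|q|<1$. For all integers $n,r\ge 0$ and all complex numbers $x,y,z,\xi,\zeta,X,Y,Z,\Omega,U$, the following summation formula for the product of trivariate $q$-polynomials holds: $$F_n(x,\xi,\zeta;q)\,F_r(X,\Omega,U;q)=\sum_{k=0}^{n}\sum_{m=0}^{r}\begin{bmatrix} n\\ k\end{bmatrix}_q\begin{bmatrix} r\\ m\end{bmatrix}_q(-1)^{k+m}q^{\binom{k+1}{2}+\binom{m+1}{2}-mr-nk}\,P_k(\xi\ominus_q\zeta,\,y\ominus_q z)\,F_{n-k}(x,y,z;q)\,P_m(\Omega\ominus_q U,\,Y\ominus_q Z)\,F_{r-m}(X,Y,Z;q).$$
   Context: Notation: $(a;q)_0=1$, $(a;q)_n=\prod_{k=0}^{n-1}(1-aq^k)$, $(a;q)_\infty=\prod_{k=0}^\infty(1-aq^k)$, and $\begin{bmatrix} n\\ k\end{bmatrix}_q=\frac{(q;q)_n}{(q;q)_k(q;q)_{n-k}}$ is the $q$-binomial coefficient. The Cauchy polynomials are $P_0(x,y)=1$, $P_n(x,y)=(x-y)(x-qy)\cdots(x-q^{n-1}y)$; one writes $(x\ominus_q y)^n:=P_n(x,y)$. They satisfy $\sum_{n\ge0}P_n(x,y)\frac{t^n}{(q;q)_n}=\frac{(yt;q)_\infty}{(xt;q)_\infty}$. The trivariate $q$-polynomials are $$F_n(x,y,z;q)=(-1)^n q^{-\binom n2}\sum_{k=0}^n \begin{bmatrix} n\\ k\end{bmatrix}_q(-1)^k q^{\binom k2}P_{n-k}(y,x)\,z^k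 .$$ The symbol $a\ominus_q b$ is symbolic (umbral): with $e_q(t)=\sum_{n\ge0}\frac{t^n}{(q;q)_n}$, one sets $e_q\big((a\ominus_q b)t\big):=\sum_{n\ge 0}\frac{(a\ominus_q b)^n t^n}{(q;q)_n}=\sum_{n\ge0}\frac{P_n(a,b)t^n}{(q;q)_n}=\frac{(bt;q)_\infty}{(at;q)_\infty}$. The quantities $P_k(a\ominus_q b,\,c\ominus_q d)$, $k\ge0$, are defined by the corresponding Cauchy generating function, as formal power series in $t$: $$\sum_{k=0}^\infty P_k(a\ominus_q b,\,c\ominus_q d)\frac{t^k}{(q;q)_k}=\frac{e_q\big((a\ominus_q b)t\big)}{e_q\big((c\ominus_q d)t\big)}=\frac{(bt;q)_\infty\,(ct;q)_\infty}{(at;q)_\infty\,(dt;q)_\infty}.$$ *)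

theory Defs
  imports Complex_Main "HOL-Computational_Algebra.Formal_Power_Series"
begin

definition qpoch :: "complex \<Rightarrow> complex \<Rightarrow> nat \<Rightarrow> complex" where
  "qpoch a q n = (\<Prod>k<n. 1 - a * q ^ k)"

definition qbinomial :: "complex \<Rightarrow> nat \<Rightarrow> nat \<Rightarrow> complex" where
  "qbinomial q n k = qpoch q q n / (qpoch q q k * qpoch q q (n - k))"

definition cauchy_poly :: "complex \<Rightarrow> nat \<Rightarrow> complex \<Rightarrow> complex \<Rightarrow> complex" where
  "cauchy_poly q n x y = (\<Prod>k<n. x - q ^ k * y)"

definition trivariate_F :: "complex \<Rightarrow> nat \<Rightarrow> complex \<Rightarrow> complex \<Rightarrow> complex \<Rightarrow> complex" where
  "trivariate_F q n x y z =
     (-1) ^ n * q powi (- int (n choose 2)) *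
     (\<Sum>k\<le>n. qbinomial q n k * (-1) ^ k * q ^ (k choose 2) * cauchy_poly q (n - k) y x * z ^ k)"

text \<open>
  The formal power series \<open>e\<^sub>q((a \<ominus>\<^sub>q b) t)\<close> in \<open>t\<close>: the symbolic power
  \<open>(a \<ominus>\<^sub>q b)\<^sup>n\<close> stands for the Cauchy polynomial \<open>P\<^sub>n(a, b)\<close>.
\<close>
definition eq_ominus :: "complex \<Rightarrow> complex \<Rightarrow> complex \<Rightarrow> complex fps" where
  "eq_ominus q a b = Abs_fps (\<lambda>n. cauchy_poly q n a b / qpoch q q n)"

text \<open>
  \<open>P\<^sub>k(a \<ominus>\<^sub>q b, c \<ominus>\<^sub>q d)\<close> is \<open>(q;q)\<^sub>k\<close> times the coefficient of \<open>t\<^sup>k\<close> in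
  \<open>e\<^sub>q((a \<ominus>\<^sub>q b) t) / e\<^sub>q((c \<ominus>\<^sub>q d) t)\<close>. The denominator has constant term 1, so this
  is a quotient by an invertible power series.
\<close>
definition cauchy_poly_ominus ::
  "complex \<Rightarrow> nat \<Rightarrow> complex \<Rightarrow> complex \<Rightarrow> complex \<Rightarrow> complex \<Rightarrow> complex" where
  "cauchy_poly_ominus q k a b c d =
     qpoch q q k * fps_nth (eq_ominus q a b / eq_ominus q c d) k"

end

theory Submission
  imports Defs
begin

text \<open>
  Write \<open>E(a,b)\<close> for the series \<open>e\<^sub>q((a \<ominus>\<^sub>q b)t) = (bt;q)\<^sub>\<infinity> / (at;q)\<^sub>\<infinity>\<close>. The summation formula is
  the product of two instances of one formula expressing \<open>F\<^sub>n(x,\<xi>,\<zeta>)\<close> through the \<open>F\<^sub>n\<^sub>-\<^sub>k(x,y,z)\<close>.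
  Up to the factor \<open>(-1)\<^sup>n q\<^bsup>-(n choose 2)\<^esup>\<close>, the polynomials \<open>F\<^sub>n(x,y,z)\<close> have the generating function
  \<open>E(0,z) E(y,x)\<close>, because \<open>(-1)\<^sup>k q\<^bsup>(k choose 2)\<^esup> z\<^sup>k = P\<^sub>k(0,z)\<close>. So that formula says that
  \[ E(0,\zeta) E(\xi,x) = \frac{E(\xi,\zeta)}{E(y,z)} \cdot E(0,z) E(y,x), \]
  in which all infinite products in \<open>y\<close> and \<open>z\<close> cancel.

  The infinite products themselves can be avoided: the cancellation only uses the cocycle law
  \<open>E(a,b) E(b,c) = E(a,c)\<close> (\<open>eq_ominus_mult\<close>). This law follows from the \<open>q\<close>-difference equation
  \<open>(1 - at) E(t) = (1 - bt) E(qt)\<close>, which together with the constant term determines a power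
  series, as long as no positive power of \<open>q\<close> equals 1 (\<open>q_difference_unique\<close>).
\<close>

unbundle fps_syntax

lemma power_Suc_neq_1:
  fixes q :: complex
  assumes "norm q < 1"
  shows "q ^ Suc n \<noteq> 1"
proof
  assume "q ^ Suc n = 1"
  then have "norm q ^ Suc n = 1"
    by (metis norm_one norm_power)
  moreover have "norm q ^ Suc n \<le> norm q"
    using assms by (intro power_Suc_le_self) auto
  ultimately show False using assms by simp
qed

lemma qpoch_Suc: "qpoch a q (Suc n) = qpoch a q n * (1 - a * q ^ n)"
  by (simp add: qpoch_def)

lemma qpoch_neq_0:
  assumes "\<And>n. q ^ Suc n \<noteq> 1"
  shows "qpoch q q n \<noteq> 0"
  using assms by (auto simp: qpoch_def)

lemma cauchy_poly_Suc: "cauchy_poly q (Suc n) a b = cauchy_poly q n a b * (a - q ^ n * b)"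
  by (simp add: cauchy_poly_def)

lemma cauchy_poly_0_left:
  "cauchy_poly q n 0 z = (-1) ^ n * q ^ (n choose 2) * z ^ n"
proof (induction n)
  case 0
  show ?case by (simp add: cauchy_poly_def numeral_2_eq_2)
next
  case (Suc n)
  have "Suc n choose 2 = n + (n choose 2)"
    by (simp add: numeral_2_eq_2)
  with Suc show ?case
    by (simp add: cauchy_poly_Suc power_add)
qed

lemma eq_ominus_nth_0: "eq_ominus q a b $ 0 = 1"
  by (simp add: eq_ominus_def cauchy_poly_def qpoch_def)

text \<open>
  Coefficientwise this is \<open>P\<^sub>n\<^sub>+\<^sub>1(a,b) = (a - q\<^sup>n b) P\<^sub>n(a,b)\<close>, divided by \<open>(q;q)\<^sub>n\<close>; the substitution
  \<open>t \<mapsto> qt\<close> accounts for the last factor \<open>1 - q\<^sup>n\<^sup>+\<^sup>1\<close> of \<open>(q;q)\<^sub>n\<^sub>+\<^sub>1\<close>.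
\<close>
lemma eq_ominus_q_difference:
  assumes "\<And>n. q ^ Suc n \<noteq> 1"
  shows "(1 - fps_const a * fps_X) * eq_ominus q a b =
         (1 - fps_const b * fps_X) * (eq_ominus q a b oo (fps_const q * fps_X))"
proof (rule fps_ext)
  fix n
  show "((1 - fps_const a * fps_X) * eq_ominus q a b) $ n =
        ((1 - fps_const b * fps_X) * (eq_ominus q a b oo (fps_const q * fps_X))) $ n"
  proof (cases n)
    case 0
    then show ?thesis by (simp add: fps_compose_linear)
  next
    case (Suc m)
    have nz: "qpoch q q m \<noteq> 0" "1 - q * q ^ m \<noteq> 0"
      using qpoch_neq_0[OF assms] assms[of m] by auto
    have "(1 - q * q ^ m) * (eq_ominus q a b $ Suc m) = (a - q ^ m * b) * (eq_ominus q a b $ m)"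
      using nz by (simp add: eq_ominus_def cauchy_poly_Suc qpoch_Suc)
    then show ?thesis
      unfolding Suc fps_compose_linear by (simp add: algebra_simps)
  qed
qed

text \<open>
  Comparing coefficients of \<open>t\<^sup>n\<^sup>+\<^sup>1\<close> gives \<open>(1 - q\<^sup>n\<^sup>+\<^sup>1) f\<^sub>n\<^sub>+\<^sub>1 = (a - b q\<^sup>n) f\<^sub>n\<close>, a recursion that can be
  solved for \<open>f\<^sub>n\<^sub>+\<^sub>1\<close>.
\<close>
lemma q_difference_unique:
  fixes f g :: "complex fps"
  assumes q: "\<And>n. q ^ Suc n \<noteq> 1"
    and f: "(1 - fps_const a * fps_X) * f = (1 - fps_const b * fps_X) * (f oo (fps_const q * fps_X))"
    and g: "(1 - fps_const a * fps_X) * g = (1 - fps_const b * fps_X) * (g oo (fps_const q * fps_X))"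
    and init: "f $ 0 = g $ 0"
  shows "f = g"
proof (rule fps_ext)
  have rec: "(1 - q ^ Suc n) * (h $ Suc n) = (a - b * q ^ n) * (h $ n)"
    if "(1 - fps_const a * fps_X) * h = (1 - fps_const b * fps_X) * (h oo (fps_const q * fps_X))"
    for h :: "complex fps" and n
    using arg_cong[OF that, of "\<lambda>h. h $ Suc n"]
    unfolding fps_compose_linear by (simp add: algebra_simps)
  fix n
  show "f $ n = g $ n"
  proof (induction n)
    case (Suc n)
    have "(1 - q ^ Suc n) * (f $ Suc n) = (1 - q ^ Suc n) * (g $ Suc n)"
      using rec[OF f, of n] rec[OF g, of n] Suc by simp
    with q[of n] show ?case by simp
  qed (rule init)
qed

text \<open>
  The product on the left satisfies the \<open>q\<close>-difference equation of \<open>E(a,c)\<close>: multiplying the equations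
  of the factors leaves a common factor \<open>1 - bt\<close>, which cancels.
\<close>
lemma eq_ominus_mult:
  assumes q: "\<And>n. q ^ Suc n \<noteq> 1"
  shows "eq_ominus q a b * eq_ominus q b c = eq_ominus q a c"
proof (rule q_difference_unique[OF q])
  let ?l = "\<lambda>u. 1 - fps_const u * fps_X :: complex fps"
  let ?s = "\<lambda>h. h oo (fps_const q * fps_X) :: complex fps"
  let ?f = "eq_ominus q a b" and ?g = "eq_ominus q b c"
  have "?l b $ 0 \<noteq> 0" by simp
  then have b: "?l b \<noteq> 0" by (metis fps_zero_nth)
  have "?l b * (?l a * (?f * ?g)) = (?l a * ?f) * (?l b * ?g)"
    by (simp only: mult_ac)
  also have "\<dots> = (?l b * ?s ?f) * (?l c * ?s ?g)"
    by (simp only: eq_ominus_q_difference[OF q])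
  also have "\<dots> = ?l b * (?l c * ?s (?f * ?g))"
    by (subst fps_compose_mult_distrib) (simp_all only: fps_mult_nth_0 fps_X_nth mult_ac, simp)
  finally show "?l a * (?f * ?g) = ?l c * ?s (?f * ?g)"
    using b by (simp only: mult_cancel_left simp_thms)
next
  show "(1 - fps_const a * fps_X) * eq_ominus q a c =
        (1 - fps_const c * fps_X) * (eq_ominus q a c oo (fps_const q * fps_X))"
    by (rule eq_ominus_q_difference[OF q])
qed (simp add: eq_ominus_nth_0)

text \<open>
  The product rule for \<open>q\<close>-exponential generating functions \<open>\<Sum> A\<^sub>n t\<^sup>n / (q;q)\<^sub>n\<close>, with the sequences given
  separately so that the rule applies to any closed form of the coefficients.
\<close>
lemma qbinomial_convolution:
  assumes q: "\<And>n. q ^ Suc n \<noteq> 1"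
    and f: "\<And>n. qpoch q q n * (f $ n) = A n"
    and g: "\<And>n. qpoch q q n * (g $ n) = B n"
  shows "qpoch q q n * ((f * g) $ n) = (\<Sum>k\<le>n. qbinomial q n k * A k * B (n - k))"
  using qpoch_neq_0[OF q]
  by (simp add: fps_mult_nth atLeast0AtMost sum_distrib_left qbinomial_def f[symmetric] g[symmetric]
      mult_ac)

lemma qpoch_eq_ominus_nth:
  assumes "\<And>n. q ^ Suc n \<noteq> 1"
  shows "qpoch q q n * (eq_ominus q a b $ n) = cauchy_poly q n a b"
  using qpoch_neq_0[OF assms] by (simp add: eq_ominus_def)

lemma trivariate_F_conv_gf:
  assumes q: "\<And>n. q ^ Suc n \<noteq> 1"
  shows "trivariate_F q n x y z =
    (-1) ^ n * q powi (- int (n choose 2)) *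
    (qpoch q q n * ((eq_ominus q 0 z * eq_ominus q y x) $ n))"
  by (simp add: trivariate_F_def cauchy_poly_0_left mult_ac
      qbinomial_convolution[OF q qpoch_eq_ominus_nth[OF q] qpoch_eq_ominus_nth[OF q]])

text \<open>
  Dividing by \<open>E(y,z)\<close> is multiplying by \<open>E(z,y)\<close>, so \<open>y\<close> and \<open>z\<close> disappear from the left-hand side by
  telescoping: \<open>E(0,z) E(z,y) E(y,x) = E(0,x)\<close>. Passing through the parameter 0 then exchanges the
  second arguments of \<open>E(\<xi>,\<zeta>) E(0,x)\<close>.
\<close>
lemma eq_ominus_change_of_parameters:
  assumes q: "\<And>n. q ^ Suc n \<noteq> 1"
  shows "eq_ominus q \<xi> \<zeta> / eq_ominus q y z * (eq_ominus q 0 z * eq_ominus q y x) =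
         eq_ominus q 0 \<zeta> * eq_ominus q \<xi> x"
proof -
  let ?E = "eq_ominus q"
  note mult = eq_ominus_mult[OF q]
  have refl: "?E a a = 1" for a
  proof -
    have "?E a a * ?E a a = ?E a a * 1" by (simp add: mult)
    moreover have "?E a a \<noteq> 0" by (metis eq_ominus_nth_0 fps_zero_nth zero_neq_one)
    ultimately show ?thesis by (simp only: mult_cancel_left simp_thms)
  qed
  have unit: "?E y z * ?E z y = 1" by (simp add: mult refl)
  have nz: "?E y z \<noteq> 0" by (metis eq_ominus_nth_0 fps_zero_nth zero_neq_one)
  have "?E \<xi> \<zeta> = (?E \<xi> \<zeta> * ?E z y) * ?E y z"
    using unit by (simp add: mult_ac)
  then have "?E \<xi> \<zeta> / ?E y z = ?E \<xi> \<zeta> * ?E z y"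
    using nz by (metis nonzero_mult_div_cancel_right)
  then have "?E \<xi> \<zeta> / ?E y z * (?E 0 z * ?E y x) = ?E \<xi> \<zeta> * (?E 0 z * (?E z y * ?E y x))"
    by (simp only: mult_ac)
  also have "\<dots> = ?E \<xi> \<zeta> * ?E 0 x"
    by (simp only: mult)
  also have "\<dots> = (?E \<xi> 0 * ?E 0 \<zeta>) * ?E 0 x"
    by (simp only: mult)
  also have "\<dots> = ?E 0 \<zeta> * (?E \<xi> 0 * ?E 0 x)"
    by (simp only: mult_ac)
  also have "\<dots> = ?E 0 \<zeta> * ?E \<xi> x"
    by (simp only: mult)
  finally show ?thesis .
qed

lemma choose_2_diff:
  assumes "k \<le> n"
  shows "int ((n - k) choose 2) + int (n * k) = int ((k + 1) choose 2) + int (n choose 2)"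
proof -
  have two: "2 * int (m choose 2) = int m * (int m - 1)" for m
    by (induction m) (auto simp: numeral_2_eq_2 algebra_simps)
  have "2 * (int ((n - k) choose 2) + int (n * k)) = 2 * (int ((k + 1) choose 2) + int (n choose 2))"
    using assms by (simp only: distrib_left two of_nat_diff of_nat_mult of_nat_add) (simp add: algebra_simps)
  then show ?thesis by simp
qed

text \<open>
  Comparison of coefficients in \<open>eq_ominus_change_of_parameters\<close>. The powers of \<open>q\<close> are the quotient of
  the normalising factors of \<open>F\<^sub>n\<close> and \<open>F\<^sub>n\<^sub>-\<^sub>k\<close>.
\<close>
lemma trivariate_F_change_of_parameters:
  assumes q0: "q \<noteq> 0" and q: "\<And>n. q ^ Suc n \<noteq> 1"
  shows "trivariate_F q n x \<xi> \<zeta> =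
    (\<Sum>k\<le>n. qbinomial q n k * (-1) ^ k * q powi (int ((k + 1) choose 2) - int (n * k)) *
       cauchy_poly_ominus q k \<xi> \<zeta> y z * trivariate_F q (n - k) x y z)"
proof -
  define G where "G m = qpoch q q m * ((eq_ominus q 0 z * eq_ominus q y x) $ m)" for m
  have F: "trivariate_F q m x y z = (-1) ^ m * q powi (- int (m choose 2)) * G m" for m
    by (simp only: trivariate_F_conv_gf[OF q] G_def)
  have coeff: "qpoch q q n * ((eq_ominus q 0 \<zeta> * eq_ominus q \<xi> x) $ n) =
    (\<Sum>k\<le>n. qbinomial q n k * cauchy_poly_ominus q k \<xi> \<zeta> y z * G (n - k))"
    unfolding eq_ominus_change_of_parameters[OF q, of \<xi> \<zeta> y z x, symmetric]
    by (rule qbinomial_convolution[OF q]) (simp_all add: cauchy_poly_ominus_def G_def)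
  have "(-1) ^ n * q powi (- int (n choose 2)) *
      (qbinomial q n k * cauchy_poly_ominus q k \<xi> \<zeta> y z * G (n - k)) =
    qbinomial q n k * (-1) ^ k * q powi (int ((k + 1) choose 2) - int (n * k)) *
      cauchy_poly_ominus q k \<xi> \<zeta> y z * trivariate_F q (n - k) x y z" if "k \<le> n" for k
  proof -
    have sign: "(-1 :: complex) ^ n = (-1) ^ k * (-1) ^ (n - k)"
      using that by (simp flip: power_add)
    have "- int (n choose 2) = (int ((k + 1) choose 2) - int (n * k)) + - int ((n - k) choose 2)"
      using choose_2_diff[OF that] by linarith
    then have "q powi (- int (n choose 2)) =
        q powi (int ((k + 1) choose 2) - int (n * k)) * q powi (- int ((n - k) choose 2))"
      using q0 by (simp only: power_int_add simp_thms)
    then show ?thesis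
      unfolding F sign by (simp only: mult_ac)
  qed
  then show ?thesis
    unfolding trivariate_F_conv_gf[OF q, of n x \<xi>] coeff sum_distrib_left
    by (intro sum.cong) auto
qed

theorem theorem8:
  fixes q x y z \<xi> \<zeta> X Y Z \<Omega> U :: complex and n r :: nat
  assumes "q \<noteq> 0" and "norm q < 1"
  shows "trivariate_F q n x \<xi> \<zeta> * trivariate_F q r X \<Omega> U =
    (\<Sum>k\<le>n. \<Sum>m\<le>r.
       qbinomial q n k * qbinomial q r m * (-1) ^ (k + m) *
       q powi (int ((k + 1) choose 2) + int ((m + 1) choose 2) - int (m * r) - int (n * k)) *
       cauchy_poly_ominus q k \<xi> \<zeta> y z * trivariate_F q (n - k) x y z *
       cauchy_poly_ominus q m \<Omega> U Y Z * trivariate_F q (r - m) X Y Z)"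
proof -
  note expand = trivariate_F_change_of_parameters[OF assms(1) power_Suc_neq_1[OF assms(2)]]
  have split: "q powi (int ((k + 1) choose 2) + int ((m + 1) choose 2) - int (m * r) - int (n * k)) =
      q powi (int ((k + 1) choose 2) - int (n * k)) * q powi (int ((m + 1) choose 2) - int (r * m))"
    for k m
    using assms(1) by (subst power_int_add[symmetric]) (simp_all add: algebra_simps)
  show ?thesis
    unfolding expand[of n x \<xi> \<zeta> y z] expand[of r X \<Omega> U Y Z] sum_product split power_add
    by (intro sum.cong refl) (simp only: mult_ac)
qed

end
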